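(* Let $x\in\mathbb{C}\setminus(\mathbb{R}^-\cup\{1\})$ and let $\nu\in\mathbb{C}$ with $\mathrm{Re}(\nu)<0$. Let $\mathscr{H}_0$ and $\mathfrak{L}:\mathscr{H}_0\to\mathscr{H}_0$ be as defined in the context. Let $K,E^*\in\mathscr{H}_0$ have the power series expansions $$E^*(z)=\sum_{\ell=1}^{+\infty}E_\ell\,\frac{z^\ell}{\ell!},\qquad K(z)=\sum_{b=1}^{+\infty}(-1)^bK_b\,\frac{z^b}{b!},\qquad z\in\mathbb{C}.$$ Then the equation $\mathfrak{L}E^*(z)=K(z)$ for all $z\in\mathbb{C}$ reduces (is equivalent) to the infinite lower-triangular linear system $$\forall\,b\in\mathbb{N}^*,\qquad\sum_{\ell=1}^{b}(-1)^\ell\binom{b}{\ell}Q_{b,\ell}\,E_\ell=K_b,$$ where $$Q_{b,\ell}=\frac{\Gamma(b)\,\Gamma(1-b\nu)}{\Gamma(b-b\nu)}\,\frac{x}{x-1}\,F(\ell-b,-b\nu;-b;x),\qquad 1\leqslant\ell\leqslant b.$$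
   Context: $\mathbb{R}^-=(-\infty,0]$, $\mathbb{N}^*=\{1,2,3,\dots\}$, $\Gamma$ is the Euler Gamma function. $\mathscr{H}_0$ is the complex linear space of entire functions on $\mathbb{C}$ vanishing at $0$. For $x\in\mathbb{C}\setminus(\mathbb{R}^-\cup\{1\})$ and $\mathrm{Re}(\nu)<0$, set $$\mathfrak{R}(\zeta)=x(1-\zeta)^{-\nu}\left(1-(1-x)\zeta\right)^{\nu-1},\quad \zeta\in[0,1],\qquad c=\frac{1-\nu x}{1-x},$$ with principal powers, and define the operator $\mathfrak{L}:\mathscr{H}_0\to\mathscr{H}_0$ by $$\mathfrak{L}f(z)=\int_0^1\left[(1+z\,\mathfrak{R}(\zeta))\,f(\zeta\,\mathfrak{R}(\zeta)\,z)-c\,z\,\mathfrak{R}(\zeta)\,f'(\zeta\,\mathfrak{R}(\zeta)\,z)\right]e^{-\mathfrak{R}(\zeta)z}\,\mathrm{d}\zeta,\qquad z\in\mathbb{C},$$ where $f'$ is the derivative of $f$. $F$ denotes the Gauss hypergeometric function. For an integer $m\geqslant0$, $F(-m,\beta;\gamma;x)=\sum_{k=0}^{m}\frac{(-m)_k(\beta)_k}{(\gamma)_k}\frac{x^k}{k!}$ is a polynomial in $x$, where $(a)_k=a(a+1)\cdots(a+k-1)$; here $m=b-\ell\leqslant b-1$ and $\gamma=-b$, so that all denominators $(\gamma)_k$, $0\leqslant k\leqslant m$, are non-zero. *)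

theory Defs
  imports "HOL-Analysis.Analysis" "HOL-Library.Nonpos_Ints"
begin

definition entire_zero :: "(complex \<Rightarrow> complex) set" where
  "entire_zero = {f. f holomorphic_on UNIV \<and> f 0 = 0}"

text \<open>Complex \<open>powr\<close> is the principal power. At \<open>\<zeta> = 1\<close> the first factor is \<open>0 powr (-\<nu>) = 0\<close>,
  which is its limit when \<open>Re \<nu> < 0\<close>; the base of the second factor runs through the segment
  from \<open>1\<close> to \<open>x\<close>, which avoids the branch cut when \<open>x\<close> does.\<close>

definition R_kernel :: "complex \<Rightarrow> complex \<Rightarrow> real \<Rightarrow> complex" where
  "R_kernel x \<nu> \<zeta> =
     x * (1 - of_real \<zeta>) powr (- \<nu>) * (1 - (1 - x) * of_real \<zeta>) powr (\<nu> - 1)"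

definition c_const :: "complex \<Rightarrow> complex \<Rightarrow> complex" where
  "c_const x \<nu> = (1 - \<nu> * x) / (1 - x)"

text \<open>For entire \<open>f\<close>, \<open>x \<notin> \<real>\<^sub>\<le>\<^sub>0\<close> and \<open>Re \<nu> < 0\<close> the integrand is continuous on \<open>[0, 1]\<close>,
  so the gauge integral is the ordinary one.\<close>

definition L_op :: "complex \<Rightarrow> complex \<Rightarrow> (complex \<Rightarrow> complex) \<Rightarrow> complex \<Rightarrow> complex" where
  "L_op x \<nu> f z = integral {0..1} (\<lambda>\<zeta>::real.
     ((1 + z * R_kernel x \<nu> \<zeta>) * f (of_real \<zeta> * R_kernel x \<nu> \<zeta> * z)
       - c_const x \<nu> * z * R_kernel x \<nu> \<zeta> * deriv f (of_real \<zeta> * R_kernel x \<nu> \<zeta> * z))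
     * exp (- R_kernel x \<nu> \<zeta> * z))"

text \<open>\<open>gauss_F_neg m \<beta> \<gamma> x\<close> is \<open>F(-m, \<beta>; \<gamma>; x)\<close>. The sum stops at \<open>m\<close> because it is also needed
  for negative integers \<open>\<gamma> < -m\<close>, where the Gauss series for a general first parameter is undefined.\<close>

definition gauss_F_neg :: "nat \<Rightarrow> complex \<Rightarrow> complex \<Rightarrow> complex \<Rightarrow> complex" where
  "gauss_F_neg m \<beta> \<gamma> x =
     (\<Sum>k=0..m. pochhammer (- of_nat m) k * pochhammer \<beta> k / pochhammer \<gamma> k * (x ^ k / fact k))"

text \<open>Only meaningful for \<open>1 \<le> l \<le> b\<close>, where the natural-number difference \<open>b - l\<close> is exact.\<close>

definition Q_coeff :: "complex \<Rightarrow> complex \<Rightarrow> nat \<Rightarrow> nat \<Rightarrow> complex" where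
  "Q_coeff x \<nu> b l =
     Gamma (of_nat b) * Gamma (1 - of_nat b * \<nu>) / Gamma (of_nat b - of_nat b * \<nu>)
       * (x / (x - 1)) * gauss_F_neg (b - l) (- of_nat b * \<nu>) (- of_nat b) x"

end

theory Submission
  imports Defs
begin

text \<open>
  Comparing Taylor coefficients turns the equation into a triangular system; the content of the theorem
  is the closed form of its entries. Write \<open>R\<close> for the kernel, \<open>E\<^sub>l / l!\<close> for the Taylor coefficients
  of \<open>f\<close>, and expand both
  \<open>(1 + w) exp (-w)\<close> and \<open>exp (-w)\<close> at \<open>w = R z\<close>. Every power of \<open>z\<close> comes with the same power of
  \<open>R\<close>, so the coefficient of \<open>z\<^sup>b / b!\<close> in the image of \<open>f\<close> is
  \<open>\<Sum>l=1..b. (-1)\<^bsup>b-l\<^esup> (b choose l) M\<^bsub>b,l\<^esub> E\<^sub>l\<close>, where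
  \<open>M\<^bsub>b,l\<^esub> = \<integral> R\<^sup>b ((1 - (b - l)) t\<^sup>l - c l t\<^bsup>l-1\<^esup>) dt\<close> over \<open>[0, 1]\<close>. The exchange of sum and
  integral is the Weierstrass M-test, since \<open>R\<close> is bounded (\<open>L_op_sums\<close>). The theorem follows by
  uniqueness of power series once \<open>M\<^bsub>b,l\<^esub> = Q\<^bsub>b,l\<^esub>\<close> for \<open>1 \<le> l \<le> b\<close> is known (\<open>kernel_moment\<close>).

  To compute \<open>M\<^bsub>b,l\<^esub>\<close>, put \<open>\<beta> = -b \<nu>\<close>, \<open>A = 1 - t\<close> and \<open>B = 1 - (1 - x) t\<close>, so that
  \<open>R\<^sup>b = x\<^sup>b A\<^bsup>\<beta>\<^esup> B\<^bsup>-\<beta>-b\<^esup>\<close>. The value of \<open>c\<close> is exactly the one for which the integrand differs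
  from a constant multiple of \<open>t\<^sup>l A\<^bsup>\<beta>-1\<^esup> B\<^bsup>-\<beta>-b-1\<^esup>\<close> by the derivative of
  \<open>x\<^sup>b t\<^sup>l (t - c) A\<^bsup>\<beta>\<^esup> B\<^bsup>-\<beta>-b\<^esup>\<close>, which vanishes at both ends of the interval. What remains is an
  Euler integral for \<open>F(-m, \<beta>; -b; x)\<close> with \<open>m = b - l\<close> (\<open>euler_integral_gauss_F_neg\<close>). It is
  evaluated by expanding \<open>1 = (t + A)\<^sup>m\<close>, which produces homogeneous integrands
  \<open>t\<^sup>i A\<^sup>s B\<^bsup>-s-i-2\<^esup>\<close>; these are Beta integrands in the variable \<open>u = x t / B\<close>, for which
  \<open>1 - u = A / B\<close> and \<open>du = x dt / B\<^sup>2\<close>. As \<open>u\<close> follows a complex path from \<open>0\<close> to \<open>1\<close>, the change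
  of variable is replaced by integration by parts in \<open>t\<close> (\<open>projective_beta_integral\<close>).
\<close>

section \<open>Integrals of Beta type along the segment from 1 to x\<close>

text \<open>The slit plane is star-shaped around \<open>1\<close>.\<close>

lemma segment_one_to_x_avoids_nonpos_Reals:
  fixes x :: complex and t :: real
  assumes x: "x \<notin> \<real>\<^sub>\<le>\<^sub>0" and t: "t \<in> {0..1}"
  shows "1 - (1 - x) * of_real t \<notin> \<real>\<^sub>\<le>\<^sub>0"
proof
  assume "1 - (1 - x) * of_real t \<in> \<real>\<^sub>\<le>\<^sub>0"
  then have re: "1 - t + Re x * t \<le> 0" and im: "Im x * t = 0"
    by (simp_all add: complex_nonpos_Reals_iff algebra_simps)
  have "t \<noteq> 0" using re by auto
  then have "Im x = 0" "t > 0" using im t by auto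
  with x have "Re x > 0" by (auto simp: complex_nonpos_Reals_iff)
  then have "Re x * t > 0" using \<open>t > 0\<close> by simp
  then show False using re t by auto
qed

lemma continuous_on_powr_one_minus:
  assumes "Re a > 0"
  shows "continuous_on {0..1} (\<lambda>t::real. (1 - of_real t :: complex) powr a)"
  using assms by (intro continuous_intros) auto

lemma continuous_on_powr_segment:
  fixes x d :: complex
  assumes x: "x \<notin> \<real>\<^sub>\<le>\<^sub>0"
  shows "continuous_on {0..1} (\<lambda>t::real. (1 - (1 - x) * of_real t) powr d)"
proof (intro continuous_on_powr_complex continuous_intros subsetI)
  fix t :: real assume t: "t \<in> {0..1}"
  note B = segment_one_to_x_avoids_nonpos_Reals[OF x t]
  show "t \<in> {z. 0 \<le> Re (1 - (1 - x) * of_real z) \<or> Im (1 - (1 - x) * of_real z) \<noteq> 0}"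
    using B unfolding complex_nonpos_Reals_iff by auto
  show "Re d > 0" if "1 - (1 - x) * of_real t = 0" using B that by auto
qed

text \<open>The fundamental theorem of calculus for \<open>p A\<^sup>a B\<^sup>d\<close>, with one factor \<open>A B\<close> pulled out of the
  derivative. Only \<open>0 < Re a\<close> is assumed, so the integrand may be unbounded at \<open>1\<close>; the gauge integral
  needs the derivative in the open interval only. All integrals below are obtained from this lemma by
  choosing the polynomial \<open>p\<close>.\<close>

lemma weight_derivative_integral:
  fixes x a d :: complex and p p' :: "complex \<Rightarrow> complex"
  assumes x: "x \<notin> \<real>\<^sub>\<le>\<^sub>0" and a: "Re a > 0"
    and p: "\<And>z. (p has_field_derivative p' z) (at z)"
  defines "A \<equiv> \<lambda>t::real. 1 - of_real t :: complex"
    and "B \<equiv> \<lambda>t::real. 1 - (1 - x) * of_real t"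
  shows "((\<lambda>t. A t powr (a - 1) * B t powr (d - 1) *
      (p' (of_real t) * A t * B t - a * p (of_real t) * B t - d * (1 - x) * p (of_real t) * A t))
    has_integral (- p 0)) {0..1}"
proof -
  define g where "g = (\<lambda>t. p (of_real t) * A t powr a * B t powr d)"
  have contp: "continuous_on {0..1} (\<lambda>t::real. p (of_real t))"
  proof -
    have "continuous_on UNIV p"
      using p by (intro continuous_at_imp_continuous_on) (auto intro: DERIV_isCont)
    then show ?thesis by (rule continuous_on_compose2) (auto intro!: continuous_intros)
  qed
  have cont: "continuous_on {0..1} g"
    unfolding g_def A_def B_def
    by (intro continuous_on_mult contp continuous_on_powr_one_minus[OF a] continuous_on_powr_segment[OF x])
  have der: "(g has_vector_derivative (A t powr (a - 1) * B t powr (d - 1) *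
      (p' (of_real t) * A t * B t - a * p (of_real t) * B t - d * (1 - x) * p (of_real t) * A t))) (at t)"
    if t: "t \<in> {0<..<1}" for t
  proof -
    have A0: "A t \<notin> \<real>\<^sub>\<le>\<^sub>0" using t by (auto simp: A_def complex_nonpos_Reals_iff)
    have B0: "B t \<notin> \<real>\<^sub>\<le>\<^sub>0"
      unfolding B_def using segment_one_to_x_avoids_nonpos_Reals[OF x] t by auto
    have Aa: "A t powr a = A t * A t powr (a - 1)"
      using A0 powr_add[of "A t" 1 "a - 1"] by simp
    have Bd: "B t powr d = B t * B t powr (d - 1)"
      using B0 powr_add[of "B t" 1 "d - 1"] by simp
    have dA: "((\<lambda>z. (1 - z) powr a) has_field_derivative (a * A t powr (a - 1) * (- 1))) (at (of_real t))"
      using A0 by (auto intro!: DERIV_chain2[OF has_field_derivative_powr] derivative_eq_intros simp: A_def)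
    have dB: "((\<lambda>z. (1 - (1 - x) * z) powr d) has_field_derivative
        (d * B t powr (d - 1) * (- (1 - x)))) (at (of_real t))"
      using B0 by (auto intro!: DERIV_chain2[OF has_field_derivative_powr] derivative_eq_intros simp: B_def)
    have prod_rule: "(p' (of_real t) * A t powr a + a * A t powr (a - 1) * - 1 * p (of_real t)) * B t powr d
          + d * B t powr (d - 1) * - (1 - x) * (p (of_real t) * A t powr a)
        = A t powr (a - 1) * B t powr (d - 1) *
          (p' (of_real t) * A t * B t - a * p (of_real t) * B t - d * (1 - x) * p (of_real t) * A t)"
      unfolding Aa Bd by (simp add: algebra_simps)
    have "((\<lambda>z. p z * (1 - z) powr a * (1 - (1 - x) * z) powr d) has_field_derivative
       (A t powr (a - 1) * B t powr (d - 1) *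
      (p' (of_real t) * A t * B t - a * p (of_real t) * B t - d * (1 - x) * p (of_real t) * A t)))
       (at (of_real t))"
      by (rule DERIV_cong[OF DERIV_mult[OF DERIV_mult[OF p dA] dB]])
         (use prod_rule in \<open>simp only: A_def B_def\<close>)
    from has_vector_derivative_real_field[OF this] show ?thesis
      unfolding g_def A_def B_def by simp
  qed
  from fundamental_theorem_of_calculus_interior[OF _ cont der] have
    "((\<lambda>t. A t powr (a - 1) * B t powr (d - 1) *
      (p' (of_real t) * A t * B t - a * p (of_real t) * B t - d * (1 - x) * p (of_real t) * A t))
      has_integral (g 1 - g 0)) {0..1}" by simp
  moreover have "g 1 = 0" "g 0 = p 0" using a by (auto simp: g_def A_def B_def)
  ultimately show ?thesis by simp
qed

text \<open>The right-hand side is \<open>x\<^bsup>-i-1\<^esup>\<close> times the Beta value at \<open>(i + 1, s + 1)\<close>, as predicted by the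
  substitution \<open>u = x t / B\<close>. The induction step moves one power of \<open>u\<close> onto \<open>1 - u\<close>: it uses
  the derivative of \<open>u\<^bsup>i+1\<^esup> (1 - u)\<^bsup>s+1\<^esup>\<close>, which in terms of \<open>t\<close> is
  \<open>x\<^bsup>i+1\<^esup> t\<^bsup>i+1\<^esup> A\<^bsup>s+1\<^esup> B\<^bsup>-s-i-2\<^esup>\<close>.\<close>

lemma projective_beta_integral:
  fixes x s :: complex
  assumes x: "x \<notin> \<real>\<^sub>\<le>\<^sub>0" and s: "Re s > - 1"
  shows "((\<lambda>t::real. of_real t ^ i * (1 - of_real t) powr s
            * (1 - (1 - x) * of_real t) powr (- s - of_nat i - 2))
    has_integral (fact i / (x ^ Suc i * pochhammer (s + 1) (Suc i)))) {0..1}"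
  using s
proof (induction i arbitrary: s)
  case 0
  have x0: "x \<noteq> 0" and s1: "s + 1 \<noteq> 0" using x 0 by (auto simp: add_eq_0_iff2)
  have "((\<lambda>t::real. (- 1 / ((s + 1) * x)) * ((1 - of_real t) powr (s + 1 - 1) *
       (1 - (1 - x) * of_real t) powr (- s - 1 - 1) * (0 * (1 - of_real t) * (1 - (1 - x) * of_real t)
        - (s + 1) * 1 * (1 - (1 - x) * of_real t) - (- s - 1) * (1 - x) * 1 * (1 - of_real t))))
      has_integral (- 1 / ((s + 1) * x)) * (- 1)) {0..1}"
    using 0 by (intro has_integral_mult_right
        weight_derivative_integral[OF x, where p = "\<lambda>_. 1" and p' = "\<lambda>_. 0"]) auto
  also have "(- 1 / ((s + 1) * x)) * (- 1) = fact 0 / (x ^ Suc 0 * pochhammer (s + 1) (Suc 0))"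
    by (simp add: mult.commute)
  finally show ?case
  proof (rule has_integral_eq[rotated])
    fix t :: real
    have "0 * (1 - of_real t) * (1 - (1 - x) * of_real t) - (s + 1) * 1 * (1 - (1 - x) * of_real t)
        - (- s - 1) * (1 - x) * 1 * (1 - of_real t) = - ((s + 1) * x)"
      by (simp add: algebra_simps)
    moreover have "s + 1 - 1 = s" "- s - 1 - 1 = - s - of_nat 0 - 2" by simp_all
    ultimately show "(- 1 / ((s + 1) * x)) * ((1 - of_real t) powr (s + 1 - 1) *
       (1 - (1 - x) * of_real t) powr (- s - 1 - 1) * (0 * (1 - of_real t) * (1 - (1 - x) * of_real t)
        - (s + 1) * 1 * (1 - (1 - x) * of_real t) - (- s - 1) * (1 - x) * 1 * (1 - of_real t)))
      = of_real t ^ 0 * (1 - of_real t) powr s * (1 - (1 - x) * of_real t) powr (- s - of_nat 0 - 2)"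
      using x0 s1 by (simp only:) (simp add: divide_simps)
  qed
next
  case (Suc i)
  have x0: "x \<noteq> 0" and s1: "s + 1 \<noteq> 0" using x Suc.prems by (auto simp: add_eq_0_iff2)
  define A where "A = (\<lambda>t::real. 1 - of_real t :: complex)"
  define B where "B = (\<lambda>t::real. 1 - (1 - x) * of_real t)"
  define e where "e = - s - of_nat i - 3"
  have der: "((\<lambda>z. z ^ Suc i) has_field_derivative (of_nat (Suc i) * z ^ i)) (at z)" for z :: complex
    by (rule DERIV_cong[OF DERIV_power_Suc[OF DERIV_ident]]) simp
  have 1: "((\<lambda>t. A t powr s * B t powr e * (of_nat (Suc i) * of_real t ^ i * A t * B t
        - (s + 1) * of_real t ^ Suc i * B t - (e + 1) * (1 - x) * of_real t ^ Suc i * A t))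
      has_integral 0) {0..1}"
    using weight_derivative_integral[OF x _ der, of "s + 1" "e + 1"] Suc.prems
    unfolding A_def B_def by simp
  have 2: "((\<lambda>t. of_real t ^ i * A t powr (s + 1) * B t powr e) has_integral
      (fact i / (x ^ Suc i * pochhammer (s + 1 + 1) (Suc i)))) {0..1}"
  proof -
    have "- (s + 1) - of_nat i - 2 = e" by (simp add: e_def)
    then show ?thesis using Suc.IH[of "s + 1"] Suc.prems unfolding A_def B_def by simp
  qed
  have "((\<lambda>t. (of_nat (Suc i) * (of_real t ^ i * A t powr (s + 1) * B t powr e)
      - A t powr s * B t powr e * (of_nat (Suc i) * of_real t ^ i * A t * B t
        - (s + 1) * of_real t ^ Suc i * B t - (e + 1) * (1 - x) * of_real t ^ Suc i * A t)) / ((s + 1) * x))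
      has_integral (of_nat (Suc i) * (fact i / (x ^ Suc i * pochhammer (s + 1 + 1) (Suc i))) - 0)
        / ((s + 1) * x)) {0..1}"
    by (intro has_integral_divide has_integral_diff has_integral_mult_right 1 2)
  also have "(of_nat (Suc i) * (fact i / (x ^ Suc i * pochhammer (s + 1 + 1) (Suc i))) - 0)
        / ((s + 1) * x) = fact (Suc i) / (x ^ Suc (Suc i) * pochhammer (s + 1) (Suc (Suc i)))"
    by (simp add: pochhammer_rec[of "s + 1" "Suc i"] mult_ac)
  finally show ?case
  proof (rule has_integral_eq[rotated])
    fix t :: real
    have As: "A t powr (s + 1) = A t * A t powr s"
      using powr_add[of "A t" s 1] by (auto simp: mult.commute)
    \<comment> \<open>Apart from expansion, all that is used here is \<open>B + (1 - x) t = 1\<close> and \<open>B - (1 - x) A = x\<close>.\<close>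
    have br: "of_nat (Suc i) * of_real t ^ i * A t - (of_nat (Suc i) * of_real t ^ i * A t * B t
        - (s + 1) * of_real t ^ Suc i * B t - (e + 1) * (1 - x) * of_real t ^ Suc i * A t)
      = (s + 1) * x * of_real t ^ Suc i"
      unfolding A_def B_def e_def by (simp add: algebra_simps)
    have "of_nat (Suc i) * (of_real t ^ i * A t powr (s + 1) * B t powr e)
      - A t powr s * B t powr e * (of_nat (Suc i) * of_real t ^ i * A t * B t
        - (s + 1) * of_real t ^ Suc i * B t - (e + 1) * (1 - x) * of_real t ^ Suc i * A t)
      = A t powr s * B t powr e * ((s + 1) * x * of_real t ^ Suc i)"
      unfolding br[symmetric] As by (simp add: algebra_simps)
    then have step: "(of_nat (Suc i) * (of_real t ^ i * A t powr (s + 1) * B t powr e)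
      - A t powr s * B t powr e * (of_nat (Suc i) * of_real t ^ i * A t * B t
        - (s + 1) * of_real t ^ Suc i * B t - (e + 1) * (1 - x) * of_real t ^ Suc i * A t)) / ((s + 1) * x)
      = of_real t ^ Suc i * A t powr s * B t powr e"
      using x0 s1 by simp
    have e': "- s - of_nat (Suc i) - 2 = e" by (simp add: e_def)
    show "(of_nat (Suc i) * (of_real t ^ i * A t powr (s + 1) * B t powr e)
      - A t powr s * B t powr e * (of_nat (Suc i) * of_real t ^ i * A t * B t
        - (s + 1) * of_real t ^ Suc i * B t - (e + 1) * (1 - x) * of_real t ^ Suc i * A t)) / ((s + 1) * x)
      = of_real t ^ Suc i * (1 - of_real t) powr s * (1 - (1 - x) * of_real t) powr (- s - of_nat (Suc i) - 2)"
      unfolding e' using step by (simp only: A_def B_def)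
  qed
qed

section \<open>The moments of the kernel\<close>

lemma R_kernel_power:
  assumes x: "x \<notin> \<real>\<^sub>\<le>\<^sub>0" and t: "t \<in> {0..1}" and b: "b > 0"
  shows "R_kernel x \<nu> t ^ b = x ^ b * (1 - of_real t) powr (- of_nat b * \<nu>)
    * (1 - (1 - x) * of_real t) powr (of_nat b * \<nu> - of_nat b)"
proof -
  have "1 - (1 - x) * of_real t \<noteq> 0"
    using segment_one_to_x_avoids_nonpos_Reals[OF x t] by auto
  then have "((1 - (1 - x) * of_real t) powr (\<nu> - 1)) ^ b
      = (1 - (1 - x) * of_real t) powr (of_nat b * \<nu> - of_nat b)"
    by (simp add: powr_power right_diff_distrib)
  moreover have "((1 - of_real t) powr (- \<nu>)) ^ b = (1 - of_real t :: complex) powr (- of_nat b * \<nu>)"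
    using b by (cases "t = 1") (auto simp: powr_power)
  ultimately show ?thesis by (simp add: R_kernel_def power_mult_distrib)
qed

text \<open>Both \<open>(-m)\<^sub>k\<close> and \<open>(-b)\<^sub>k\<close> are signed falling factorials; their signs cancel, and \<open>b!\<close> clears the
  denominators.\<close>

lemma gauss_F_neg_binomial_sum:
  assumes "m \<le> b"
  shows "fact b * gauss_F_neg m \<beta> (- of_nat b) x
    = (\<Sum>k\<le>m. of_nat (m choose k) * fact (b - k) * pochhammer \<beta> k * x ^ k)"
proof -
  have poch: "pochhammer (- of_nat n :: complex) k = (- 1) ^ k * of_nat (n choose k) * fact k" for n k :: nat
    by (simp add: binomial_gbinomial gbinomial_pochhammer flip: power_mult_distrib)
  have "fact b * (pochhammer (- of_nat m) k * pochhammer \<beta> k / pochhammer (- of_nat b) k * (x ^ k / fact k))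
      = of_nat (m choose k) * fact (b - k) * pochhammer \<beta> k * x ^ k" if "k \<le> m" for k
  proof -
    have k: "k \<le> b" using that assms by simp
    have f: "(fact b :: complex) = of_nat (b choose k) * fact k * fact (b - k)"
      using binomial_fact[OF k, where ?'a = complex] by simp
    have "of_nat (b choose k) \<noteq> (0::complex)" using k by simp
    then show ?thesis unfolding poch f by (simp add: field_simps)
  qed
  then show ?thesis
    unfolding gauss_F_neg_def sum_distrib_left atMost_atLeast0 by (intro sum.cong) auto
qed

text \<open>The exponents of \<open>A\<close> and \<open>B\<close> are such that after multiplication by \<open>1 = (t + A)\<^sup>m\<close> each term of
  the binomial expansion is a homogeneous integrand, whose value carries the \<open>k\<close>-th term of the
  binomial form of \<open>F\<close>. In the variable \<open>u\<close> this is the Euler-type integral of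
  \<open>u\<^sup>l (1 - u)\<^bsup>\<beta>-1\<^esup> (u + x (1 - u))\<^sup>m\<close>, up to a power of \<open>x\<close>.\<close>

lemma euler_integral_gauss_F_neg:
  fixes x \<beta> :: complex
  assumes x: "x \<notin> \<real>\<^sub>\<le>\<^sub>0" and \<beta>: "Re \<beta> > 0"
  shows "((\<lambda>t::real. of_real t ^ l * (1 - of_real t) powr (\<beta> - 1)
            * (1 - (1 - x) * of_real t) powr (- \<beta> - of_nat (l + m) - 1))
    has_integral (fact (l + m) * gauss_F_neg m \<beta> (- of_nat (l + m)) x
      / (x ^ Suc (l + m) * pochhammer \<beta> (Suc (l + m))))) {0..1}"
proof -
  define A where "A = (\<lambda>t::real. 1 - of_real t :: complex)"
  define B where "B = (\<lambda>t::real. 1 - (1 - x) * of_real t)"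
  define e where "e = - \<beta> - of_nat (l + m) - 1"
  have x0: "x \<noteq> 0" using x by auto
  have nz: "\<beta> + of_nat j \<noteq> 0" for j :: nat
  proof
    assume "\<beta> + of_nat j = 0"
    from arg_cong[OF this, of Re] show False using \<beta> by simp
  qed
  have term_integral: "((\<lambda>t. of_nat (m choose k) * (of_real t ^ (l + m - k) * A t powr (\<beta> + of_nat k - 1) * B t powr e))
      has_integral of_nat (m choose k) * (fact (l + m - k) * pochhammer \<beta> k * x ^ k
        / (x ^ Suc (l + m) * pochhammer \<beta> (Suc (l + m))))) {0..1}" if k: "k \<le> m" for k
  proof -
    have "- (\<beta> + of_nat k - 1) - of_nat (l + m - k) - 2 = e"
      using k by (simp add: e_def of_nat_diff)
    moreover have "Re (\<beta> + of_nat k - 1) > - 1" using \<beta> by simp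
    ultimately have "((\<lambda>t. of_real t ^ (l + m - k) * A t powr (\<beta> + of_nat k - 1) * B t powr e)
      has_integral (fact (l + m - k) / (x ^ Suc (l + m - k) * pochhammer (\<beta> + of_nat k) (Suc (l + m - k))))) {0..1}"
      using projective_beta_integral[OF x, of "\<beta> + of_nat k - 1" "l + m - k"]
      unfolding A_def B_def by simp
    moreover have "fact (l + m - k) / (x ^ Suc (l + m - k) * pochhammer (\<beta> + of_nat k) (Suc (l + m - k)))
      = fact (l + m - k) * pochhammer \<beta> k * x ^ k / (x ^ Suc (l + m) * pochhammer \<beta> (Suc (l + m)))"
    proof -
      have "pochhammer \<beta> (Suc (l + m)) = pochhammer \<beta> k * pochhammer (\<beta> + of_nat k) (Suc (l + m - k))"
        using pochhammer_product[of k "Suc (l + m)" \<beta>] k by (simp add: Suc_diff_le)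
      moreover have "x ^ Suc (l + m) = x ^ k * x ^ Suc (l + m - k)"
        using k by (simp flip: power_add power_Suc)
      moreover have "pochhammer \<beta> k \<noteq> 0" 
        using nz by (auto simp: pochhammer_eq_0_iff add_eq_0_iff2)
      ultimately show ?thesis using x0 by simp
    qed
    ultimately show ?thesis by (intro has_integral_mult_right) simp
  qed
  have "((\<lambda>t. \<Sum>k\<le>m. of_nat (m choose k) * (of_real t ^ (l + m - k) * A t powr (\<beta> + of_nat k - 1) * B t powr e))
      has_integral (\<Sum>k\<le>m. of_nat (m choose k) * (fact (l + m - k) * pochhammer \<beta> k * x ^ k
        / (x ^ Suc (l + m) * pochhammer \<beta> (Suc (l + m)))))) {0..1}"
    by (intro has_integral_sum term_integral) auto
  also have "(\<Sum>k\<le>m. of_nat (m choose k) * (fact (l + m - k) * pochhammer \<beta> k * x ^ k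
        / (x ^ Suc (l + m) * pochhammer \<beta> (Suc (l + m)))))
      = fact (l + m) * gauss_F_neg m \<beta> (- of_nat (l + m)) x
        / (x ^ Suc (l + m) * pochhammer \<beta> (Suc (l + m)))"
    by (subst gauss_F_neg_binomial_sum) (simp, simp only: sum_divide_distrib times_divide_eq_right mult.assoc)
  finally show ?thesis
  proof (rule has_integral_eq[rotated])
    fix t :: real
    have Ak: "A t powr (\<beta> + of_nat k - 1) = A t ^ k * A t powr (\<beta> - 1)" for k :: nat
    proof (cases "A t = 0")
      case False
      then show ?thesis using powr_add[of "A t" "of_nat k" "\<beta> - 1"]
        by (simp add: powr_nat' algebra_simps)
    qed auto
    have "(\<Sum>k\<le>m. of_nat (m choose k) * (of_real t ^ (l + m - k) * A t powr (\<beta> + of_nat k - 1) * B t powr e))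
      = (\<Sum>k\<le>m. of_nat (m choose k) * A t ^ k * of_real t ^ (m - k)) * (of_real t ^ l * A t powr (\<beta> - 1) * B t powr e)"
      unfolding sum_distrib_right
    proof (intro sum.cong refl)
      fix k assume "k \<in> {..m}"
      then have "l + m - k = l + (m - k)" by simp
      then show "of_nat (m choose k) * (of_real t ^ (l + m - k) * A t powr (\<beta> + of_nat k - 1) * B t powr e)
        = of_nat (m choose k) * A t ^ k * of_real t ^ (m - k) * (of_real t ^ l * A t powr (\<beta> - 1) * B t powr e)"
        by (simp only: Ak power_add) (simp add: mult_ac)
    qed
    also have "(\<Sum>k\<le>m. of_nat (m choose k) * A t ^ k * of_real t ^ (m - k)) = (A t + of_real t) ^ m"
      by (rule binomial_ring[symmetric])
    also have "A t + of_real t = 1" by (simp add: A_def)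
    finally show "(\<Sum>k\<le>m. of_nat (m choose k) * (of_real t ^ (l + m - k) * A t powr (\<beta> + of_nat k - 1) * B t powr e))
      = of_real t ^ l * (1 - of_real t) powr (\<beta> - 1)
            * (1 - (1 - x) * of_real t) powr (- \<beta> - of_nat (l + m) - 1)"
      by (simp add: A_def B_def e_def)
  qed
qed

text \<open>Each entry of the triangular system is a moment of a power of the kernel. With \<open>b = l + m\<close>, the integrand
  equals \<open>x\<^sup>b (D - \<kappa> W)\<close>, where \<open>D\<close> is the derivative of \<open>t\<^sup>l (t - c) A\<^bsup>\<beta>\<^esup> B\<^bsup>-\<beta>-b\<^esup>\<close> and \<open>W\<close> is the
  integrand of the preceding lemma. The integral of \<open>D\<close> vanishes because \<open>l > 0\<close> kills the boundary
  term at \<open>0\<close> and \<open>0 < Re \<beta>\<close> the one at \<open>1\<close>.\<close>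

lemma kernel_moment:
  fixes x \<nu> :: complex
  assumes x: "x \<notin> \<real>\<^sub>\<le>\<^sub>0" and x1: "x \<noteq> 1" and \<nu>: "Re \<nu> < 0" and l: "l > 0"
  shows "((\<lambda>t. R_kernel x \<nu> t ^ (l + m) *
      ((1 - of_nat m) * of_real t ^ l - c_const x \<nu> * of_nat l * of_real t ^ (l - 1)))
    has_integral Q_coeff x \<nu> (l + m) l) {0..1}"
proof -
  define A where "A = (\<lambda>t::real. 1 - of_real t :: complex)"
  define B where "B = (\<lambda>t::real. 1 - (1 - x) * of_real t)"
  define b where "b = l + m"
  define \<beta> where "\<beta> = - of_nat b * \<nu>"
  define c where "c = c_const x \<nu>"
  define \<kappa> where "\<kappa> = x\<^sup>2 * \<beta> * (\<beta> + of_nat b) / (of_nat b * (1 - x))"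
  define p where "p = (\<lambda>z. z ^ l * (z - c))"
  define p' where "p' = (\<lambda>z. of_nat l * z ^ (l - 1) * (z - c) + z ^ l)"
  have b0: "b > 0" using l by (simp add: b_def)
  have Re\<beta>: "Re \<beta> > 0" using b0 \<nu> by (simp add: \<beta>_def mult_pos_neg)
  have x0: "x \<noteq> 0" using x by auto
  have nz: "\<beta> + of_nat j \<noteq> 0" for j :: nat
  proof
    assume "\<beta> + of_nat j = 0"
    from arg_cong[OF this, of Re] show False using Re\<beta> by simp
  qed
  have c: "of_nat b * (1 - x) * c = of_nat b + \<beta> * x"
    using x1 by (simp add: c_def c_const_def \<beta>_def field_simps)
  have \<kappa>: "of_nat b * (1 - x) * \<kappa> = x\<^sup>2 * \<beta> * (\<beta> + of_nat b)"
    using x1 b0 by (simp add: \<kappa>_def)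
  have der: "(p has_field_derivative p' z) (at z)" for z
    unfolding p_def p'_def by (auto intro!: derivative_eq_intros simp: l)
  have p0: "p 0 = 0" using l by (simp add: p_def)
  define D where "D = (\<lambda>t. A t powr (\<beta> - 1) * B t powr (- \<beta> - of_nat b - 1) *
      (p' (of_real t) * A t * B t - \<beta> * p (of_real t) * B t
        - (- \<beta> - of_nat b) * (1 - x) * p (of_real t) * A t))"
  have D: "(D has_integral 0) {0..1}"
    using weight_derivative_integral[OF x Re\<beta> der, of "- \<beta> - of_nat b"] p0
    unfolding D_def A_def B_def by simp
  define W where "W = (\<lambda>t. of_real t ^ l * A t powr (\<beta> - 1) * B t powr (- \<beta> - of_nat b - 1))"
  have W: "(W has_integral (fact b * gauss_F_neg m \<beta> (- of_nat b) x
      / (x ^ Suc b * pochhammer \<beta> (Suc b)))) {0..1}"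
    using euler_integral_gauss_F_neg[OF x Re\<beta>, of l m]
    unfolding W_def A_def B_def b_def by simp
  have "((\<lambda>t. x ^ b * D t - x ^ b * \<kappa> * W t) has_integral
     (x ^ b * 0 - x ^ b * \<kappa> * (fact b * gauss_F_neg m \<beta> (- of_nat b) x
      / (x ^ Suc b * pochhammer \<beta> (Suc b))))) {0..1}"
    by (intro has_integral_diff has_integral_mult_right D W)
  also have "x ^ b * 0 - x ^ b * \<kappa> * (fact b * gauss_F_neg m \<beta> (- of_nat b) x
      / (x ^ Suc b * pochhammer \<beta> (Suc b))) = Q_coeff x \<nu> b l"
  proof -
    obtain n where n: "b = Suc n" using b0 gr0_implies_Suc by blast
    define P where "P = pochhammer (1 + \<beta>) n"
    have P0: "P \<noteq> 0"
    proof
      assume "P = 0"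
      then obtain k where k: "1 + \<beta> = - of_nat k" by (auto simp: P_def pochhammer_eq_0_iff)
      have "\<beta> + of_nat (Suc k) = (1 + \<beta>) + of_nat k" by simp
      then show False using k nz[of "Suc k"] by simp
    qed
    have poch: "pochhammer \<beta> (Suc b) = \<beta> * P * (\<beta> + of_nat b)"
      unfolding pochhammer_Suc[of \<beta> b] by (simp add: n P_def pochhammer_rec add.commute)
    have np: "1 + \<beta> \<notin> \<int>\<^sub>\<le>\<^sub>0"
    proof
      assume "1 + \<beta> \<in> \<int>\<^sub>\<le>\<^sub>0"
      then obtain j where "1 + \<beta> = - of_nat j" by (auto elim: nonpos_Ints_cases')
      from arg_cong[OF this, of Re] show False using Re\<beta> by simp
    qed
    have G: "Gamma (1 + \<beta>) \<noteq> 0" using np by (simp add: Gamma_eq_zero_iff)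
    have "1 - of_nat b * \<nu> = 1 + \<beta>" "of_nat b - of_nat b * \<nu> = of_nat b + \<beta>" "- of_nat b * \<nu> = \<beta>" "b - l = m"
      by (simp_all add: \<beta>_def) (simp add: b_def)
    then have Q_eq: "Q_coeff x \<nu> b l = Gamma (of_nat b) * Gamma (1 + \<beta>) / Gamma (of_nat b + \<beta>)
        * (x / (x - 1)) * gauss_F_neg m \<beta> (- of_nat b) x"
      by (simp only: Q_coeff_def)
    have "P = Gamma (1 + \<beta> + of_nat n) / Gamma (1 + \<beta>)"
      unfolding P_def by (rule pochhammer_Gamma[OF np])
    then have "Gamma (of_nat b + \<beta>) = P * Gamma (1 + \<beta>)"
      using G by (simp add: n add_ac)
    moreover have "Gamma (of_nat b :: complex) = fact n"
      unfolding n using Gamma_fact[of n, where ?'a = complex] by (simp add: add.commute)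
    ultimately have Q: "Q_coeff x \<nu> b l = fact n / P * (x / (x - 1)) * gauss_F_neg m \<beta> (- of_nat b) x"
      using G unfolding Q_eq by simp
    have "fact b = of_nat b * (fact n :: complex)" by (simp add: n)
    moreover have "of_nat b \<noteq> (0::complex)" "\<beta> \<noteq> 0" "\<beta> + of_nat b \<noteq> 0"
      using b0 nz[of 0] nz[of b] by auto
    ultimately have "x ^ b * \<kappa> * (fact b * gauss_F_neg m \<beta> (- of_nat b) x
        / (x ^ Suc b * (\<beta> * P * (\<beta> + of_nat b))))
      = fact n / P * (x / (1 - x)) * gauss_F_neg m \<beta> (- of_nat b) x"
      using x0 by (simp add: \<kappa>_def power2_eq_square mult_ac)
    moreover have "x / (1 - x) = - (x / (x - 1))"
      by (simp add: minus_divide_right)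
    ultimately show ?thesis unfolding Q poch by simp
  qed
  finally have "((\<lambda>t. x ^ b * D t - x ^ b * \<kappa> * W t) has_integral Q_coeff x \<nu> b l) {0..1}" .
  then show ?thesis unfolding b_def[symmetric] c_def[symmetric]
  proof (rule has_integral_eq[rotated])
    fix t :: real assume t: "t \<in> {0..1}"
    define u where "u = (of_real t :: complex)"
    obtain j where j: "l = Suc j" using l gr0_implies_Suc by blast
    have B0: "B t \<noteq> 0" using segment_one_to_x_avoids_nonpos_Reals[OF x t] by (auto simp: B_def)
    have Ab: "A t powr \<beta> = A t * A t powr (\<beta> - 1)"
      using powr_add[of "A t" 1 "\<beta> - 1"] Re\<beta> by auto
    have Bb: "B t powr (- \<beta> - of_nat b) = B t * B t powr (- \<beta> - of_nat b - 1)"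
      using powr_add[of "B t" 1 "- \<beta> - of_nat b - 1"] B0 by simp
    have R: "R_kernel x \<nu> t ^ b = x ^ b * A t powr \<beta> * B t powr (- \<beta> - of_nat b)"
      using R_kernel_power[OF x t b0] by (simp add: A_def B_def \<beta>_def)
    \<comment> \<open>The \<open>t\<^sup>2\<close> terms in this polynomial cancel; the \<open>t\<close> terms cancel by the choice of \<open>c\<close>, the constants by that of \<open>\<kappa>\<close>.\<close>
    have "of_nat b * (1 - x) * (- of_nat b * A t * B t
        + (u - c) * (\<beta> * B t - (\<beta> + of_nat b) * (1 - x) * A t) + \<kappa>)
      = - (of_nat b ^ 2) * (1 - x) * A t * B t
        + (of_nat b * (1 - x) * u - of_nat b * (1 - x) * c) * (\<beta> * B t - (\<beta> + of_nat b) * (1 - x) * A t)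
        + of_nat b * (1 - x) * \<kappa>"
      by (simp add: algebra_simps power2_eq_square)
    also have "\<dots> = 0"
      unfolding c \<kappa> by (simp add: A_def B_def u_def[symmetric] algebra_simps power2_eq_square)
    finally have "- of_nat b * A t * B t
        + (u - c) * (\<beta> * B t - (\<beta> + of_nat b) * (1 - x) * A t) + \<kappa> = 0"
      using b0 x1 by simp
    then have \<kappa>': "\<kappa> = of_nat b * A t * B t - (u - c) * (\<beta> * B t - (\<beta> + of_nat b) * (1 - x) * A t)"
      by (simp add: algebra_simps eq_neg_iff_add_eq_0)
    have m: "of_nat m = (of_nat b - 1 - of_nat j :: complex)" by (simp add: b_def j)
    have bracket: "p' u * A t * B t - \<beta> * p u * B t - (- \<beta> - of_nat b) * (1 - x) * p u * A t - \<kappa> * u ^ l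
      = A t * B t * ((1 - of_nat m) * u ^ l - c * of_nat l * u ^ (l - 1))"
      unfolding \<kappa>' p_def p'_def m j by (simp add: algebra_simps)
    have "x ^ b * D t - x ^ b * \<kappa> * W t = x ^ b * A t powr (\<beta> - 1) * B t powr (- \<beta> - of_nat b - 1)
      * (A t * B t * ((1 - of_nat m) * u ^ l - c * of_nat l * u ^ (l - 1)))"
      unfolding D_def W_def u_def[symmetric] bracket[symmetric] by (simp only: right_diff_distrib mult_ac)
    also have "\<dots> = R_kernel x \<nu> t ^ b * ((1 - of_nat m) * u ^ l - c * of_nat l * u ^ (l - 1))"
      unfolding R Ab Bb by (simp only: mult_ac)
    finally show "x ^ b * D t - x ^ b * \<kappa> * W t
      = R_kernel x \<nu> t ^ b * ((1 - of_nat m) * of_real t ^ l - c * of_nat l * of_real t ^ (l - 1))"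
      by (simp only: u_def)
  qed
qed

section \<open>Coefficients of entire functions\<close>

definition entire_coeffs :: "(nat \<Rightarrow> 'a::{real_normed_field,banach}) \<Rightarrow> bool" where
  "entire_coeffs a \<longleftrightarrow> (\<forall>z. summable (\<lambda>n. a n * z ^ n))"

lemma entire_coeffs_summable_norm:
  assumes "entire_coeffs a"
  shows "summable (\<lambda>n. norm (a n * z ^ n))"
proof (rule powser_insidea)
  show "summable (\<lambda>n. a n * of_real (norm z + 1) ^ n)"
    using assms by (auto simp: entire_coeffs_def)
  show "norm z < norm (of_real (norm z + 1) :: 'a)" by (simp only: norm_of_real)
qed

text \<open>The series of \<open>z f'(z)\<close>.\<close>

lemma entire_coeffs_of_nat_mult:
  assumes "entire_coeffs a"
  shows "entire_coeffs (\<lambda>n. of_nat n * a n)"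
  unfolding entire_coeffs_def
proof
  fix z :: 'a
  have "summable (\<lambda>n. diffs a n * z ^ n)"
    using assms by (intro termdiff_converges_all) (auto simp: entire_coeffs_def)
  then have "summable (\<lambda>n. z * (diffs a n * z ^ n))" by (rule summable_mult)
  then have "summable (\<lambda>n. of_nat (Suc n) * a (Suc n) * z ^ Suc n)"
    by (simp add: diffs_def mult_ac)
  then show "summable (\<lambda>n. of_nat n * a n * z ^ n)" by (subst (asm) summable_Suc_iff)
qed

lemma entire_coeffs_inverse_fact: "entire_coeffs (\<lambda>n. 1 / fact n)"
  using summable_exp by (auto simp: entire_coeffs_def divide_inverse mult.commute)

lemma entire_coeffs_norm:
  fixes a :: "nat \<Rightarrow> 'a::{real_normed_field,banach}"
  assumes "entire_coeffs a"
  shows "entire_coeffs (\<lambda>n. norm (a n))"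
  unfolding entire_coeffs_def
proof
  fix r :: real
  have "summable (\<lambda>n. norm (norm (a n) * r ^ n))"
    using entire_coeffs_summable_norm[OF assms, of "of_real r"] by (simp add: norm_mult norm_power abs_mult power_abs)
  then show "summable (\<lambda>n. norm (a n) * r ^ n)" by (rule summable_norm_cancel)
qed

text \<open>The weights \<open>\<phi>\<close> will be powers of \<open>t \<in> [0, 1]\<close>, which leave the variable \<open>w\<close> free to carry the kernel.\<close>

lemma weighted_Cauchy_product_sums:
  fixes a b \<phi> :: "nat \<Rightarrow> complex"
  assumes a: "entire_coeffs a" and b: "entire_coeffs b" and \<phi>: "\<And>n. norm (\<phi> n) \<le> 1"
  shows "(\<lambda>n. (\<Sum>l\<le>n. a l * \<phi> l * b (n - l)) * w ^ n)
    sums ((\<Sum>l. a l * \<phi> l * w ^ l) * (\<Sum>k. b k * w ^ k))"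
proof -
  have "summable (\<lambda>n. norm (a n * \<phi> n * w ^ n))"
  proof (rule summable_comparison_test'[OF entire_coeffs_summable_norm[OF a, of w]])
    show "norm (norm (a n * \<phi> n * w ^ n)) \<le> norm (a n * w ^ n)" if "n \<ge> 0" for n
      using mult_left_mono[OF \<phi>[of n], of "norm (a n * w ^ n)"] by (simp add: norm_mult mult_ac)
  qed
  from Cauchy_product_sums[OF this entire_coeffs_summable_norm[OF b, of w]]
  show ?thesis
  proof (rule sums_cong[THEN iffD1, rotated])
    fix n
    have "a l * \<phi> l * w ^ l * (b (n - l) * w ^ (n - l)) = a l * \<phi> l * b (n - l) * w ^ n" if "l \<le> n" for l
    proof -
      have "w ^ n = w ^ l * w ^ (n - l)" using that by (simp flip: power_add)
      then show ?thesis by (simp add: mult_ac)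
    qed
    then show "(\<Sum>l\<le>n. a l * \<phi> l * w ^ l * (b (n - l) * w ^ (n - l)))
      = (\<Sum>l\<le>n. a l * \<phi> l * b (n - l)) * w ^ n"
      unfolding sum_distrib_right by (intro sum.cong) auto
  qed
qed

lemma powser_times_exp_neg:
  fixes w :: complex
  shows "(\<Sum>k. (- 1) ^ k / fact k * w ^ k) = exp (- w)"
    and "(\<Sum>k. (1 - of_nat k) * (- 1) ^ k / fact k * w ^ k) = (1 + w) * exp (- w)"
proof -
  have e: "(\<lambda>k. (- 1) ^ k / fact k * w ^ k) sums exp (- w)"
    using exp_converges[of "- w"] by (simp add: scaleR_conv_of_real power_minus[of w] field_simps)
  then show "(\<Sum>k. (- 1) ^ k / fact k * w ^ k) = exp (- w)" by (simp add: sums_iff)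
  have "(\<lambda>k. of_nat (Suc k) * (- 1) ^ Suc k / fact (Suc k) * w ^ Suc k) sums (- w * exp (- w))"
  proof (rule sums_cong[THEN iffD1, OF _ sums_mult[OF e, of "- w"]])
    fix k
    have "(fact (Suc k) :: complex) = of_nat (Suc k) * fact k" by simp
    then show "- w * ((- 1) ^ k / fact k * w ^ k)
      = of_nat (Suc k) * (- 1) ^ Suc k / fact (Suc k) * w ^ Suc k"
      by (simp only:) (simp del: of_nat_Suc)
  qed
  then have "(\<lambda>k. of_nat k * (- 1) ^ k / fact k * w ^ k) sums (- w * exp (- w))"
    by (subst (asm) sums_Suc_iff) simp
  from sums_diff[OF e this] show "(\<Sum>k. (1 - of_nat k) * (- 1) ^ k / fact k * w ^ k) = (1 + w) * exp (- w)"
    by (simp add: sums_iff algebra_simps diff_divide_distrib)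
qed

lemma powser_coeffs_eq_iff:
  fixes a b :: "nat \<Rightarrow> complex"
  assumes "\<And>z. (\<lambda>n. a n * z ^ n) sums F z" "\<And>z. (\<lambda>n. b n * z ^ n) sums G z"
  shows "(\<forall>z. F z = G z) \<longleftrightarrow> (\<forall>n. a n = b n)"
proof
  assume FG: "\<forall>z. F z = G z"
  have "Abs_fps a = Abs_fps b"
  proof (rule eval_fps_eqD)
    have "conv_radius a = \<infinity>" "conv_radius b = \<infinity>"
      using assms by (auto intro!: conv_radius_inftyI'' simp: sums_iff)
    then show "fps_conv_radius (Abs_fps a) > 0" "fps_conv_radius (Abs_fps b) > 0"
      by (simp_all add: fps_conv_radius_def)
    show "\<forall>\<^sub>F z in nhds 0. eval_fps (Abs_fps a) z = eval_fps (Abs_fps b) z"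
      using FG assms by (auto simp: eval_fps_def sums_iff)
  qed
  then show "\<forall>n. a n = b n" by (simp add: fps_eq_iff)
next
  assume "\<forall>n. a n = b n"
  then show "\<forall>z. F z = G z" using assms by (metis (no_types, lifting) ext sums_unique2)
qed

section \<open>The power series of the image under the operator\<close>

text \<open>The coefficient of \<open>w\<^sup>n\<close> in \<open>((1 + w) f (t w) - c w f' (t w)) exp (-w)\<close>, for \<open>f\<close> with Taylor coefficients
  \<open>a\<close>; with \<open>w = R z\<close> this is the integrand of the operator. For \<open>l = 0\<close> the
  truncated exponent \<open>l - 1\<close> is harmless, as its term has the factor \<open>l\<close>.\<close>

definition L_op_coeff :: "complex \<Rightarrow> (nat \<Rightarrow> complex) \<Rightarrow> nat \<Rightarrow> real \<Rightarrow> complex" where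
  "L_op_coeff c a n t = (\<Sum>l\<le>n. a l * ((- 1) ^ (n - l) / fact (n - l)) *
     ((1 - of_nat (n - l)) * of_real t ^ l - c * of_nat l * of_real t ^ (l - 1)))"

lemma L_op_coeff_sums:
  fixes a :: "nat \<Rightarrow> complex"
  assumes a: "entire_coeffs a" and f: "\<And>z. f z = (\<Sum>n. a n * z ^ n)" and t: "t \<in> {0..1}"
  shows "(\<lambda>n. L_op_coeff c a n t * w ^ n)
    sums (((1 + w) * f (of_real t * w) - c * w * deriv f (of_real t * w)) * exp (- w))"
proof -
  define b where "b = (\<lambda>k. (- 1) ^ k / fact k :: complex)"
  define b1 where "b1 = (\<lambda>k. (1 - of_nat k) * (- 1) ^ k / fact k :: complex)"
  have b: "entire_coeffs b"
    unfolding entire_coeffs_def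
  proof
    fix z :: complex
    show "summable (\<lambda>n. b n * z ^ n)"
      using summable_exp[of "- z"] by (simp add: b_def power_minus[of z] field_simps)
  qed
  have b1: "entire_coeffs b1"
    unfolding entire_coeffs_def
  proof
    fix z :: complex
    have "summable (\<lambda>n. b n * z ^ n - of_nat n * b n * z ^ n)"
      using b entire_coeffs_of_nat_mult[OF b] by (intro summable_diff) (auto simp: entire_coeffs_def)
    then show "summable (\<lambda>n. b1 n * z ^ n)"
      by (simp add: b1_def b_def algebra_simps diff_divide_distrib)
  qed
  have tn: "norm (of_real t ^ n :: complex) \<le> 1" for n
    using t by (simp add: norm_power power_le_one)
  have "(\<lambda>n. (\<Sum>l\<le>n. a l * of_real t ^ l * b1 (n - l)) * w ^ n)
      sums ((\<Sum>l. a l * of_real t ^ l * w ^ l) * (\<Sum>k. b1 k * w ^ k))"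
    by (rule weighted_Cauchy_product_sums[OF a b1 tn])
  also have "(\<Sum>l. a l * of_real t ^ l * w ^ l) = f (of_real t * w)"
    by (simp add: f power_mult_distrib mult.assoc)
  also have "(\<Sum>k. b1 k * w ^ k) = (1 + w) * exp (- w)"
    unfolding b1_def by (rule powser_times_exp_neg)
  finally have 1: "(\<lambda>n. (\<Sum>l\<le>n. a l * of_real t ^ l * b1 (n - l)) * w ^ n)
      sums (f (of_real t * w) * ((1 + w) * exp (- w)))" .
  have "(\<lambda>n. (\<Sum>l\<le>n. of_nat l * a l * of_real t ^ (l - 1) * b (n - l)) * w ^ n)
      sums ((\<Sum>l. of_nat l * a l * of_real t ^ (l - 1) * w ^ l) * (\<Sum>k. b k * w ^ k))"
    by (rule weighted_Cauchy_product_sums[OF entire_coeffs_of_nat_mult[OF a] b tn])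
  also have "(\<Sum>k. b k * w ^ k) = exp (- w)"
    unfolding b_def by (rule powser_times_exp_neg)
  also have "(\<Sum>l. of_nat l * a l * of_real t ^ (l - 1) * w ^ l) = w * deriv f (of_real t * w)"
  proof -
    have sa: "summable (\<lambda>n. a n * z ^ n)" for z using a by (simp add: entire_coeffs_def)
    have "f = (\<lambda>z. \<Sum>n. a n * z ^ n)" using f by auto
    then have "deriv f (of_real t * w) = (\<Sum>n. diffs a n * (of_real t * w) ^ n)"
      using termdiffs_strong_converges_everywhere[OF sa] by (auto intro: DERIV_imp_deriv)
    moreover have "summable (\<lambda>n. diffs a n * (of_real t * w) ^ n)"
      by (intro termdiff_converges_all sa)
    ultimately have "(\<lambda>n. w * (diffs a n * (of_real t * w) ^ n)) sums (w * deriv f (of_real t * w))"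
      by (intro sums_mult) (simp add: summable_sums)
    then have "(\<lambda>n. of_nat (Suc n) * a (Suc n) * of_real t ^ (Suc n - 1) * w ^ Suc n)
        sums (w * deriv f (of_real t * w))"
      by (simp add: diffs_def power_mult_distrib mult_ac)
    then have "(\<lambda>n. of_nat n * a n * of_real t ^ (n - 1) * w ^ n) sums (w * deriv f (of_real t * w))"
      by (subst (asm) sums_Suc_iff) simp
    then show ?thesis by (simp add: sums_iff)
  qed
  finally have 2: "(\<lambda>n. (\<Sum>l\<le>n. of_nat l * a l * of_real t ^ (l - 1) * b (n - l)) * w ^ n)
      sums (w * deriv f (of_real t * w) * exp (- w))" .
  have "(\<lambda>n. (\<Sum>l\<le>n. a l * of_real t ^ l * b1 (n - l)) * w ^ n
        - c * ((\<Sum>l\<le>n. of_nat l * a l * of_real t ^ (l - 1) * b (n - l)) * w ^ n))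
      sums (f (of_real t * w) * ((1 + w) * exp (- w)) - c * (w * deriv f (of_real t * w) * exp (- w)))"
    by (intro sums_diff sums_mult 1 2)
  moreover have "(\<Sum>l\<le>n. a l * of_real t ^ l * b1 (n - l)) * w ^ n
        - c * ((\<Sum>l\<le>n. of_nat l * a l * of_real t ^ (l - 1) * b (n - l)) * w ^ n)
      = L_op_coeff c a n t * w ^ n" for n
  proof -
    have "a l * ((- 1) ^ k / fact k) * ((1 - of_nat k) * u - c * of_nat l * v)
        = a l * u * b1 k - c * (of_nat l * a l * v * b k)" for l k u v
      by (simp add: b_def b1_def algebra_simps diff_divide_distrib)
    then have "L_op_coeff c a n t = (\<Sum>l\<le>n. a l * of_real t ^ l * b1 (n - l)
        - c * (of_nat l * a l * of_real t ^ (l - 1) * b (n - l)))"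
      unfolding L_op_coeff_def by (simp only:)
    then show ?thesis by (simp add: sum_subtractf sum_distrib_left left_diff_distrib)
  qed
  ultimately show ?thesis by (simp add: algebra_simps)
qed

text \<open>The M-test needs a bound independent of \<open>t\<close>. It comes from
  \<open>\<bar>(1 - k) t\<^sup>l - c l t\<^bsup>l-1\<^esup>\<bar> \<le> (1 + k) (1 + \<bar>c\<bar> l)\<close>, whose product form makes the bound a Cauchy product again.\<close>

lemma L_op_coeff_summable_bound:
  fixes a :: "nat \<Rightarrow> complex"
  assumes a: "entire_coeffs a"
  obtains M where "entire_coeffs M" "\<And>n t. t \<in> {0..1} \<Longrightarrow> norm (L_op_coeff c a n t) \<le> M n"
proof
  define a' where "a' = (\<lambda>l. norm (a l) + norm c * (of_nat l * norm (a l)))"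
  define d where "d = (\<lambda>k. 1 / fact k + real k * (1 / fact k))"
  define M where "M = (\<lambda>n. \<Sum>l\<le>n. a' l * d (n - l))"
  have a': "entire_coeffs a'"
    unfolding entire_coeffs_def
  proof
    fix r :: real
    have "summable (\<lambda>n. norm (a n) * r ^ n + norm c * (of_nat n * norm (a n) * r ^ n))"
      using entire_coeffs_norm[OF a] entire_coeffs_of_nat_mult[OF entire_coeffs_norm[OF a]]
      by (intro summable_add summable_mult) (auto simp: entire_coeffs_def)
    then show "summable (\<lambda>n. a' n * r ^ n)" by (simp add: a'_def algebra_simps)
  qed
  have d: "entire_coeffs d"
    unfolding entire_coeffs_def
  proof
    fix r :: real
    have e: "entire_coeffs (\<lambda>n. 1 / fact n :: real)" by (rule entire_coeffs_inverse_fact)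
    have "summable (\<lambda>n. 1 / fact n * r ^ n + real n * (1 / fact n) * r ^ n)"
      using e entire_coeffs_of_nat_mult[OF e]
      unfolding entire_coeffs_def by (intro summable_add) blast+
    then show "summable (\<lambda>n. d n * r ^ n)" unfolding d_def distrib_right .
  qed
  show "entire_coeffs M"
    unfolding entire_coeffs_def
  proof
    fix r :: real
    have "summable (\<lambda>n. \<Sum>l\<le>n. a' l * r ^ l * (d (n - l) * r ^ (n - l)))"
      by (intro summable_Cauchy_product entire_coeffs_summable_norm a' d)
    moreover have "(\<Sum>l\<le>n. a' l * r ^ l * (d (n - l) * r ^ (n - l))) = M n * r ^ n" for n
      unfolding M_def sum_distrib_right
    proof (intro sum.cong refl)
      fix l assume "l \<in> {..n}"
      then have "r ^ n = r ^ l * r ^ (n - l)" by (simp flip: power_add)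
      then show "a' l * r ^ l * (d (n - l) * r ^ (n - l)) = a' l * d (n - l) * r ^ n" by (simp add: mult_ac)
    qed
    ultimately show "summable (\<lambda>n. M n * r ^ n)" by simp
  qed
  show "norm (L_op_coeff c a n t) \<le> M n" if t: "t \<in> {0..1}" for n t
    unfolding L_op_coeff_def M_def
  proof (intro sum_norm_le)
    fix l
    define k where "k = n - l"
    have tn: "norm (of_real t ^ j :: complex) \<le> 1" for j
      using t by (simp add: norm_power power_le_one)
    have k1: "norm (1 - of_nat k :: complex) \<le> 1 + real k"
      using norm_triangle_ineq4[of 1 "of_nat k :: complex"] by simp
    have "norm ((1 - of_nat k) * of_real t ^ l - c * of_nat l * of_real t ^ (l - 1))
      \<le> norm (1 - of_nat k :: complex) * norm (of_real t ^ l :: complex)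
        + norm (c * of_nat l) * norm (of_real t ^ (l - 1) :: complex)"
      by (metis norm_mult norm_triangle_ineq4)
    also have "\<dots> \<le> (1 + real k) * 1 + norm (c * of_nat l) * 1"
      using tn k1 by (intro add_mono mult_mono) auto
    also have "\<dots> \<le> (1 + real k) * (1 + norm c * of_nat l)"
      by (simp add: norm_mult algebra_simps)
    finally have "norm (a l * ((- 1) ^ k / fact k) *
        ((1 - of_nat k) * of_real t ^ l - c * of_nat l * of_real t ^ (l - 1)))
      \<le> norm (a l) * (1 / fact k) * ((1 + real k) * (1 + norm c * of_nat l))"
      by (simp add: norm_mult norm_divide norm_power mult_left_mono divide_right_mono)
    also have "\<dots> = a' l * d k" by (simp add: a'_def d_def algebra_simps add_divide_distrib)
    finally show "norm (a l * ((- 1) ^ (n - l) / fact (n - l)) *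
        ((1 - of_nat (n - l)) * of_real t ^ l - c * of_nat l * of_real t ^ (l - 1))) \<le> a' l * d (n - l)"
      by (simp add: k_def)
  qed
qed

lemma continuous_on_R_kernel:
  assumes "x \<notin> \<real>\<^sub>\<le>\<^sub>0" "Re \<nu> < 0"
  shows "continuous_on {0..1} (R_kernel x \<nu>)"
  unfolding R_kernel_def using assms
  by (intro continuous_on_mult continuous_on_const continuous_on_powr_one_minus continuous_on_powr_segment) auto

text \<open>Since \<open>R\<close> is bounded on \<open>[0, 1]\<close>, the expansion of the integrand in powers of \<open>R z\<close> converges uniformly in
  \<open>t\<close> for fixed \<open>z\<close> and may be integrated term by term.\<close>

lemma L_op_sums:
  fixes a :: "nat \<Rightarrow> complex"
  assumes x: "x \<notin> \<real>\<^sub>\<le>\<^sub>0" and \<nu>: "Re \<nu> < 0"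
    and a: "entire_coeffs a" and f: "\<And>z. f z = (\<Sum>n. a n * z ^ n)"
    and T: "\<And>n. ((\<lambda>t. R_kernel x \<nu> t ^ n * L_op_coeff (c_const x \<nu>) a n t) has_integral T n) {0..1}"
  shows "(\<lambda>n. T n * z ^ n) sums L_op x \<nu> f z"
proof -
  define R where "R = R_kernel x \<nu>"
  define P where "P = L_op_coeff (c_const x \<nu>) a"
  define g where "g = (\<lambda>t. ((1 + z * R t) * f (of_real t * R t * z)
       - c_const x \<nu> * z * R t * deriv f (of_real t * R t * z)) * exp (- R t * z))"
  have contR: "continuous_on {0..1} R"
    unfolding R_def by (rule continuous_on_R_kernel[OF x \<nu>])
  then have "bounded (R ` {0..1})"
    by (intro compact_imp_bounded compact_continuous_image) auto
  then obtain C where C: "\<And>t. t \<in> {0..1} \<Longrightarrow> norm (R t) \<le> C"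
    unfolding bounded_iff by blast
  obtain M where M: "entire_coeffs M" and PM: "\<And>n t. t \<in> {0..1} \<Longrightarrow> norm (P n t) \<le> M n"
    unfolding P_def using L_op_coeff_summable_bound[OF a] by metis
  have g: "g t = (\<Sum>n. P n t * (R t * z) ^ n)" if "t \<in> {0..1}" for t
  proof -
    have "(\<lambda>n. P n t * (R t * z) ^ n) sums g t"
      using L_op_coeff_sums[OF a f that, of "c_const x \<nu>" "R t * z"]
      unfolding g_def P_def by (simp add: mult_ac)
    then show ?thesis by (simp add: sums_iff)
  qed
  have "uniform_limit {0..1} (\<lambda>N t. \<Sum>n<N. P n t * (R t * z) ^ n)
      (\<lambda>t. \<Sum>n. P n t * (R t * z) ^ n) sequentially"
  proof (rule Weierstrass_m_test)
    show "summable (\<lambda>n. M n * (C * norm z) ^ n)" using M by (simp add: entire_coeffs_def)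
    show "norm (P n t * (R t * z) ^ n) \<le> M n * (C * norm z) ^ n" if t: "t \<in> {0..1}" for n t
      unfolding norm_mult norm_power
      using PM[OF t, of n] C[OF t] order_trans[OF norm_ge_zero PM[OF t, of n]]
      by (intro mult_mono power_mono mult_right_mono) auto
  qed
  then have "uniform_limit {0..1} (\<lambda>N t. \<Sum>n<N. P n t * (R t * z) ^ n) g sequentially"
    by (rule uniform_limit_cong'[THEN iffD1, rotated -1]) (auto simp: g)
  moreover have "continuous_on {0..1} (\<lambda>t. \<Sum>n<N. P n t * (R t * z) ^ n)" for N
    unfolding P_def L_op_coeff_def by (intro continuous_intros contR)
  ultimately obtain I J where
    I: "\<And>N. ((\<lambda>t. \<Sum>n<N. P n t * (R t * z) ^ n) has_integral I N) {0..1}"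
    and J: "(g has_integral J) {0..1}" and IJ: "I \<longlonglongrightarrow> J"
    by (rule uniform_limit_integral) auto
  have "I N = (\<Sum>n<N. T n * z ^ n)" for N
  proof (rule has_integral_unique[OF I])
    have "((\<lambda>t. \<Sum>n<N. R t ^ n * P n t * z ^ n) has_integral (\<Sum>n<N. T n * z ^ n)) {0..1}"
      unfolding R_def P_def by (intro has_integral_sum has_integral_mult_left T) auto
    then show "((\<lambda>t. \<Sum>n<N. P n t * (R t * z) ^ n) has_integral (\<Sum>n<N. T n * z ^ n)) {0..1}"
      by (simp add: power_mult_distrib mult_ac)
  qed
  then have "I = (\<lambda>N. \<Sum>n<N. T n * z ^ n)" by (rule ext)
  moreover have "L_op x \<nu> f z = J"
    using J unfolding L_op_def g_def R_def by (rule integral_unique)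
  ultimately show ?thesis using IJ by (simp add: sums_def)
qed

section \<open>The triangular system\<close>

theorem proposition3p1:
  fixes x \<nu> :: complex
    and Kfun Estar :: "complex \<Rightarrow> complex"
    and K E :: "nat \<Rightarrow> complex"
  assumes "x \<notin> \<real>\<^sub>\<le>\<^sub>0" and "x \<noteq> 1" and "Re \<nu> < 0"
    and "Kfun \<in> entire_zero" and "Estar \<in> entire_zero"
    and "\<And>z. (\<lambda>n. E (Suc n) * (z ^ Suc n / fact (Suc n))) sums Estar z"
    and "\<And>z. (\<lambda>n. (- 1) ^ Suc n * K (Suc n) * (z ^ Suc n / fact (Suc n))) sums Kfun z"
  shows "(\<forall>z. L_op x \<nu> Estar z = Kfun z) \<longleftrightarrow>
    (\<forall>b\<ge>1. (\<Sum>l=1..b. (- 1) ^ l * of_nat (b choose l) * Q_coeff x \<nu> b l * E l) = K b)"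
proof -
  note x = assms(1) and x1 = assms(2) and \<nu> = assms(3)
  define a where "a = (\<lambda>n. if n = 0 then 0 else E n / fact n)"
  define k where "k = (\<lambda>n. if n = 0 then 0 else (- 1) ^ n * K n / fact n)"
  define T where "T = (\<lambda>n. \<Sum>l=1..n. a l * ((- 1) ^ (n - l) / fact (n - l)) * Q_coeff x \<nu> n l)"
  have a_sums: "(\<lambda>n. a n * z ^ n) sums Estar z" for z
  proof -
    have "(\<lambda>n. a (Suc n) * z ^ Suc n) sums Estar z" using assms(6)[of z] by (simp add: a_def)
    then show ?thesis by (subst (asm) sums_Suc_iff) (simp add: a_def)
  qed
  have k_sums: "(\<lambda>n. k n * z ^ n) sums Kfun z" for z
  proof -
    have "(\<lambda>n. k (Suc n) * z ^ Suc n) sums Kfun z" using assms(7)[of z] by (simp add: k_def)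
    then show ?thesis by (subst (asm) sums_Suc_iff) (simp add: k_def)
  qed
  have a: "entire_coeffs a" using a_sums by (auto simp: entire_coeffs_def sums_iff)
  have Estar: "Estar z = (\<Sum>n. a n * z ^ n)" for z using a_sums by (simp add: sums_iff)
  have T: "((\<lambda>t. R_kernel x \<nu> t ^ n * L_op_coeff (c_const x \<nu>) a n t) has_integral T n) {0..1}" for n
  proof -
    have "((\<lambda>t. \<Sum>l=1..n. a l * ((- 1) ^ (n - l) / fact (n - l)) * (R_kernel x \<nu> t ^ n *
          ((1 - of_nat (n - l)) * of_real t ^ l - c_const x \<nu> * of_nat l * of_real t ^ (l - 1))))
        has_integral T n) {0..1}"
      unfolding T_def
    proof (intro has_integral_sum has_integral_mult_right)
      fix l assume "l \<in> {1..n}"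
      then have "l > 0" "l + (n - l) = n" by auto
      then show "((\<lambda>t. R_kernel x \<nu> t ^ n *
          ((1 - of_nat (n - l)) * of_real t ^ l - c_const x \<nu> * of_nat l * of_real t ^ (l - 1)))
        has_integral Q_coeff x \<nu> n l) {0..1}"
        using kernel_moment[OF x x1 \<nu>, of l "n - l"] by (simp only:)
    qed simp
    then show ?thesis
    proof (rule has_integral_eq[rotated])
      fix t :: real
      \<comment> \<open>The term \<open>l = 0\<close>, to which the moment formula does not apply, disappears because \<open>Estar 0 = 0\<close>.\<close>
      have "L_op_coeff (c_const x \<nu>) a n t = (\<Sum>l=1..n. a l * ((- 1) ^ (n - l) / fact (n - l)) *
          ((1 - of_nat (n - l)) * of_real t ^ l - c_const x \<nu> * of_nat l * of_real t ^ (l - 1)))"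
        unfolding L_op_coeff_def by (rule sum.mono_neutral_right) (auto simp: a_def not_le)
      then show "(\<Sum>l=1..n. a l * ((- 1) ^ (n - l) / fact (n - l)) * (R_kernel x \<nu> t ^ n *
          ((1 - of_nat (n - l)) * of_real t ^ l - c_const x \<nu> * of_nat l * of_real t ^ (l - 1))))
        = R_kernel x \<nu> t ^ n * L_op_coeff (c_const x \<nu>) a n t"
        by (simp only: sum_distrib_left mult.left_commute)
    qed
  qed
  have "(\<forall>z. L_op x \<nu> Estar z = Kfun z) \<longleftrightarrow> (\<forall>n. T n = k n)"
    by (rule powser_coeffs_eq_iff[OF L_op_sums[OF x \<nu> a Estar T] k_sums])
  also have "\<dots> \<longleftrightarrow> (\<forall>b\<ge>1. T b = k b)"
  proof -
    \<comment> \<open>The system has no equation for \<open>b = 0\<close>, where both constant terms vanish.\<close>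
    have "T 0 = k 0" by (simp add: T_def k_def)
    then show ?thesis by (metis One_nat_def not_less_eq_eq less_one linorder_not_le)
  qed
  also have "\<dots> \<longleftrightarrow>
    (\<forall>b\<ge>1. (\<Sum>l=1..b. (- 1) ^ l * of_nat (b choose l) * Q_coeff x \<nu> b l * E l) = K b)"
  proof (intro all_cong)
    fix b :: nat assume b: "1 \<le> b"
    have T_eq: "T b = ((- 1) ^ b / fact b) * (\<Sum>l=1..b. (- 1) ^ l * of_nat (b choose l) * Q_coeff x \<nu> b l * E l)"
      unfolding T_def sum_distrib_left
    proof (intro sum.cong refl)
      fix l assume l: "l \<in> {1..b}"
      then have "(- 1) ^ b = (- 1 :: complex) ^ (b - l) * (- 1) ^ l" by (simp flip: power_add)
      then have s: "(- 1) ^ b * (- 1) ^ l = (- 1 :: complex) ^ (b - l)" by (simp add: mult.assoc)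
      have "of_nat (b choose l) = (fact b / (fact l * fact (b - l)) :: complex)"
        using l by (intro binomial_fact) auto
      then show "a l * ((- 1) ^ (b - l) / fact (b - l)) * Q_coeff x \<nu> b l
        = (- 1) ^ b / fact b * ((- 1) ^ l * of_nat (b choose l) * Q_coeff x \<nu> b l * E l)"
        using l s[symmetric] by (simp add: a_def)
    qed
    have k_eq: "k b = ((- 1) ^ b / fact b) * K b" using b by (simp add: k_def)
    show "T b = k b \<longleftrightarrow> (\<Sum>l=1..b. (- 1) ^ l * of_nat (b choose l) * Q_coeff x \<nu> b l * E l) = K b"
      unfolding T_eq k_eq by simp
  qed
  finally show ?thesis .
qed

end
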